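(* Suppose the category $\mathcal{G}$ of finite graphs, with the class $\mathcal{W}_\times$ of all $\times$-homotopy equivalences as weak equivalences, admits a cofibration category structure for some class of cofibrations. Then every cofibration is an induced inclusion, i.e. the class of cofibrations is a subclass of the class of induced inclusions.
   Context: Graphs: $\mathcal{G}$ is the category of finite undirected graphs without multiple edges (loops are allowed; the empty graph is allowed). A morphism (graph map) is a function on vertices that sends edges to edges. An induced inclusion is a graph map $i:A\to B$ that is injective on vertices and such that $uv\in E(A)$ if and only if $i(u)i(v)\in E(B)$, for all $u,v\in V(A)$ (including $u=v$); i.e. it identifies $A$ with an induced subgraph of $B$. Product: $G\times H$ has vertex set $V(G)\times V(H)$, and $(g,h)(g',h')$ is an edge iff $gg'\in E(G)$ and $hh'\in E(H)$. For $n\in\mathbb{N}$, $I_n$ is the graph with vertex set $\{0,1,\dots,n\}$ and edge set $\{ij : |i-j|\le 1\}$ (so every vertex is looped). $\times$-homotopy: graph maps $f,g:A\to B$ are $\times$-homotopic, $f\simeq_\times g$, if for some $n\in\mathbb{N}$ there is a graph map $F:A\times I_n\to B$ with $F|_{A\times\{0\}}=f$ and $F|_{A\times\{n\}}=g$. A graph map $f:A\to B$ is a $\times$-homotopy equivalence if there is a graph map $g:B\to A$ with $gf\simeq_\times 1_A$ and $fg\simeq_\times 1_B$. Cofibration category: a category with two distinguished subclasses of morphisms, weak equivalences and cofibrations, satisfying: (1) weak equivalences satisfy the 2 out of 6 property: for composable morphisms $f:A\to B$, $g:B\to C$, $h:C\to D$, if $gf$ and $hg$ are weak equivalences, then so are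 $f,g,h$ and $hgf$; (2) every isomorphism is an acyclic cofibration, i.e. both a weak equivalence and a cofibration; (3) an initial object exists; (4) every object $X$ is cofibrant, i.e. the map from the initial object to $X$ is a cofibration; (5) cofibrations and acyclic cofibrations are preserved under cobase change (pushout along arbitrary morphisms); (6) every morphism factors as a cofibration followed by a weak equivalence.
   Formalization: The class of cofibrations is additionally assumed closed under composition, as in the standard definition of a cofibration category; with only axioms (1)–(6) for an arbitrary subclass of morphisms, the claim fails. *)

theory Defs
  imports "HOL-Library.FuncSet" "HOL-Library.Infinite_Typeclass"
begin

section \<open>Categories\<close>

record ('o, 'm) cat =
  Obj :: "'o set"
  Arr :: "'m set"
  Dom :: "'m \<Rightarrow> 'o"
  Cod :: "'m \<Rightarrow> 'o"
  Ident :: "'o \<Rightarrow> 'm"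
  Comp :: "'m \<Rightarrow> 'm \<Rightarrow> 'm"

text \<open>\<open>Comp K g f\<close> is \<open>g\<close> after \<open>f\<close>; it is meaningful only if \<open>Cod K f = Dom K g\<close>.\<close>

definition homs :: "('o, 'm) cat \<Rightarrow> 'o \<Rightarrow> 'o \<Rightarrow> 'm set" where
  "homs K A B = {f \<in> Arr K. Dom K f = A \<and> Cod K f = B}"

locale category =
  fixes K :: "('o, 'm) cat"
  assumes Dom_Obj: "f \<in> Arr K \<Longrightarrow> Dom K f \<in> Obj K"
    and Cod_Obj: "f \<in> Arr K \<Longrightarrow> Cod K f \<in> Obj K"
    and Ident_homs: "A \<in> Obj K \<Longrightarrow> Ident K A \<in> homs K A A"
    and Comp_homs: "f \<in> homs K A B \<Longrightarrow> g \<in> homs K B D \<Longrightarrow> Comp K g f \<in> homs K A D"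
    and Comp_Ident_right: "f \<in> homs K A B \<Longrightarrow> Comp K f (Ident K A) = f"
    and Comp_Ident_left: "f \<in> homs K A B \<Longrightarrow> Comp K (Ident K B) f = f"
    and Comp_assoc: "f \<in> homs K A B \<Longrightarrow> g \<in> homs K B D \<Longrightarrow> h \<in> homs K D E \<Longrightarrow>
      Comp K h (Comp K g f) = Comp K (Comp K h g) f"

definition is_iso :: "('o, 'm) cat \<Rightarrow> 'm \<Rightarrow> bool" where
  "is_iso K f \<longleftrightarrow> f \<in> Arr K \<and>
     (\<exists>g \<in> homs K (Cod K f) (Dom K f).
        Comp K g f = Ident K (Dom K f) \<and> Comp K f g = Ident K (Cod K f))"

definition is_initial :: "('o, 'm) cat \<Rightarrow> 'o \<Rightarrow> bool" where
  "is_initial K I \<longleftrightarrow> I \<in> Obj K \<and> (\<forall>X \<in> Obj K. \<exists>!f. f \<in> homs K I X)"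

text \<open>\<open>is_pushout K f g f' g'\<close>: the square \<open>g' f = f' g\<close> is a pushout of \<open>f : A \<rightarrow> B\<close> and
  \<open>g : A \<rightarrow> X\<close>, with \<open>f' : X \<rightarrow> P\<close> the cobase change of \<open>f\<close> along \<open>g\<close> and \<open>g' : B \<rightarrow> P\<close>.\<close>

definition is_pushout :: "('o, 'm) cat \<Rightarrow> 'm \<Rightarrow> 'm \<Rightarrow> 'm \<Rightarrow> 'm \<Rightarrow> bool" where
  "is_pushout K f g f' g' \<longleftrightarrow>
     f \<in> Arr K \<and> g \<in> Arr K \<and> f' \<in> Arr K \<and> g' \<in> Arr K \<and>
     Dom K f = Dom K g \<and> Dom K g' = Cod K f \<and> Dom K f' = Cod K g \<and> Cod K f' = Cod K g' \<and>
     Comp K g' f = Comp K f' g \<and>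
     (\<forall>Q u v. u \<in> homs K (Cod K f) Q \<and> v \<in> homs K (Cod K g) Q \<and> Comp K u f = Comp K v g \<longrightarrow>
        (\<exists>!w. w \<in> homs K (Cod K f') Q \<and> Comp K w g' = u \<and> Comp K w f' = v))"

section \<open>Cofibration categories\<close>

text \<open>As usual for cofibration categories, the cofibrations form a subcategory: they contain the
  identities by \<open>iso_acyclic_cofibration\<close> and are closed under composition by
  \<open>cofibration_Comp\<close>. Weak equivalences are then closed under composition by \<open>two_out_of_six\<close>.
  Preservation under cobase change is required of every pushout square that exists; the existence
  of pushouts is not part of the definition.\<close>

locale cofibration_category = category K
  for K :: "('o, 'm) cat" +
  fixes W C :: "'m set"
  assumes weak_equivalences_Arr: "W \<subseteq> Arr K"
    and cofibrations_Arr: "C \<subseteq> Arr K"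
    and cofibration_Comp: "f \<in> C \<Longrightarrow> g \<in> C \<Longrightarrow> Cod K f = Dom K g \<Longrightarrow> Comp K g f \<in> C"
    and two_out_of_six:
      "f \<in> homs K X1 X2 \<Longrightarrow> g \<in> homs K X2 X3 \<Longrightarrow> h \<in> homs K X3 X4 \<Longrightarrow>
       Comp K g f \<in> W \<Longrightarrow> Comp K h g \<in> W \<Longrightarrow>
       f \<in> W \<and> g \<in> W \<and> h \<in> W \<and> Comp K h (Comp K g f) \<in> W"
    and iso_acyclic_cofibration: "is_iso K f \<Longrightarrow> f \<in> W \<inter> C"
    and initial_exists: "\<exists>I. is_initial K I"
    and all_cofibrant: "is_initial K I \<Longrightarrow> X \<in> Obj K \<Longrightarrow> f \<in> homs K I X \<Longrightarrow> f \<in> C"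
    and cobase_change_cofibration: "f \<in> C \<Longrightarrow> is_pushout K f g f' g' \<Longrightarrow> f' \<in> C"
    and cobase_change_acyclic_cofibration:
      "f \<in> W \<inter> C \<Longrightarrow> is_pushout K f g f' g' \<Longrightarrow> f' \<in> W \<inter> C"
    and factorization: "f \<in> Arr K \<Longrightarrow>
      \<exists>Z. \<exists>c \<in> homs K (Dom K f) Z. \<exists>w \<in> homs K Z (Cod K f). c \<in> C \<and> w \<in> W \<and> f = Comp K w c"

section \<open>Finite graphs\<close>

text \<open>An edge \<open>uv\<close> is the set \<open>{u, v}\<close>; a loop at \<open>u\<close> is \<open>{u, u} = {u}\<close>.\<close>

record 'a graph =
  verts :: "'a set"
  edges :: "'a set set"

definition finite_graph :: "'a graph \<Rightarrow> bool" where
  "finite_graph G \<longleftrightarrow> finite (verts G) \<and>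
     (\<forall>e \<in> edges G. \<exists>u \<in> verts G. \<exists>v \<in> verts G. e = {u, v})"

definition graph_map :: "'a graph \<Rightarrow> 'b graph \<Rightarrow> ('a \<Rightarrow> 'b) \<Rightarrow> bool" where
  "graph_map A B f \<longleftrightarrow> f \<in> verts A \<rightarrow> verts B \<and>
     (\<forall>u \<in> verts A. \<forall>v \<in> verts A. {u, v} \<in> edges A \<longrightarrow> {f u, f v} \<in> edges B)"

definition induced_inclusion :: "'a graph \<Rightarrow> 'b graph \<Rightarrow> ('a \<Rightarrow> 'b) \<Rightarrow> bool" where
  "induced_inclusion A B i \<longleftrightarrow> graph_map A B i \<and> inj_on i (verts A) \<and>
     (\<forall>u \<in> verts A. \<forall>v \<in> verts A. {u, v} \<in> edges A \<longleftrightarrow> {i u, i v} \<in> edges B)"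

definition graph_prod :: "'a graph \<Rightarrow> 'b graph \<Rightarrow> ('a \<times> 'b) graph" where
  "graph_prod G H =
     \<lparr>verts = verts G \<times> verts H,
      edges = {{(g, h), (g', h')} | g h g' h'. {g, g'} \<in> edges G \<and> {h, h'} \<in> edges H}\<rparr>"

definition interval_graph :: "nat \<Rightarrow> nat graph" where
  "interval_graph n =
     \<lparr>verts = {0..n}, edges = {{i, j} | i j. i \<le> n \<and> j \<le> n \<and> \<bar>int i - int j\<bar> \<le> 1}\<rparr>"

definition times_homotopic :: "'a graph \<Rightarrow> 'b graph \<Rightarrow> ('a \<Rightarrow> 'b) \<Rightarrow> ('a \<Rightarrow> 'b) \<Rightarrow> bool" where
  "times_homotopic A B f g \<longleftrightarrow>
     (\<exists>n F. graph_map (graph_prod A (interval_graph n)) B F \<and>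
        (\<forall>a \<in> verts A. F (a, 0) = f a \<and> F (a, n) = g a))"

definition times_homotopy_equivalence :: "'a graph \<Rightarrow> 'b graph \<Rightarrow> ('a \<Rightarrow> 'b) \<Rightarrow> bool" where
  "times_homotopy_equivalence A B f \<longleftrightarrow> graph_map A B f \<and>
     (\<exists>g. graph_map B A g \<and> times_homotopic A A (g \<circ> f) id \<and> times_homotopic B B (f \<circ> g) id)"

section \<open>The category of finite graphs\<close>

text \<open>The vertices are drawn from an infinite type \<open>'a\<close>, so that every finite graph is isomorphic
  to an object. The underlying function of a morphism is extensional, i.e. fixed outside the
  vertex set of its source, so that equality of morphisms is equality on vertices.\<close>

record 'a graph_mor =
  src :: "'a graph"
  tgt :: "'a graph"
  fn :: "'a \<Rightarrow> 'a"

definition graph_category :: "('a::infinite graph, 'a graph_mor) cat" where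
  "graph_category =
     \<lparr>Obj = {G. finite_graph G},
      Arr = {m. finite_graph (src m) \<and> finite_graph (tgt m) \<and>
                fn m \<in> extensional (verts (src m)) \<and> graph_map (src m) (tgt m) (fn m)},
      Dom = src,
      Cod = tgt,
      Ident = (\<lambda>G. \<lparr>src = G, tgt = G, fn = restrict id (verts G)\<rparr>),
      Comp = (\<lambda>n m. \<lparr>src = src m, tgt = tgt n, fn = compose (verts (src m)) (fn n) (fn m)\<rparr>)\<rparr>"

definition times_equivalences :: "'a::infinite graph_mor set" where
  "times_equivalences =
     {m \<in> Arr graph_category. times_homotopy_equivalence (src m) (tgt m) (fn m)}"

definition induced_inclusions :: "'a::infinite graph_mor set" where
  "induced_inclusions = {m \<in> Arr graph_category. induced_inclusion (src m) (tgt m) (fn m)}"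

lemma category_graph_category: "category (graph_category :: ('a::infinite graph, 'a graph_mor) cat)"
  by unfold_locales
    (auto simp: graph_category_def homs_def graph_map_def compose_def extensional_def Pi_iff
      fun_eq_iff)

end

theory Submission
  imports Defs
begin

text \<open>
  There is in fact no cofibration category structure on finite graphs with the
  \<open>\<times>\<close>-homotopy equivalences as weak equivalences, so the statement holds vacuously.

  Let \<open>1\<close> be the looped point and factor \<open>1 + 1 \<rightarrow> 1\<close> as a cofibration \<open>1 + 1 \<rightarrow> Z\<close> followed by a
  weak equivalence. The two points of \<open>Z\<close> are joined by a walk of looped vertices, of length \<open>L\<close> say.
  For \<open>n > L\<close> factor the end points \<open>1 + 1 \<rightarrow> I\<^sub>n\<close> in the same way through \<open>M\<close>, and glue \<open>M\<close> to \<open>Z\<close>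
  along \<open>1 + 1\<close>. The result \<open>T\<close> maps to the reflexive \<open>n\<close>-cycle, \<open>M\<close> wrapping around it once and
  \<open>Z\<close> going to a point, so \<open>T\<close> contains a closed walk whose image has winding number one.
  Left properness would make the collapse of the contractible \<open>M\<close> in \<open>T\<close> a weak equivalence, but
  after the collapse only \<open>L\<close> steps of the walk remain, too few to go around the \<open>n\<close>-cycle. As the
  winding number is invariant under \<open>\<times>\<close>-homotopy, this is a contradiction. Instead of left
  properness, a construction that collapses \<open>M\<close> in one of two homotopic copies of \<open>T\<close> is enough.
\<close>

section \<open>Cofibration categories with pushouts\<close>

context category
begin

lemma homs_Obj: "f \<in> homs K A B \<Longrightarrow> A \<in> Obj K \<and> B \<in> Obj K"
  using Dom_Obj Cod_Obj by (auto simp: homs_def)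

lemma is_pushout_homs:
  assumes "is_pushout K f g f' g'" "f \<in> homs K A B" "g \<in> homs K A X"
  obtains P where "f' \<in> homs K X P" "g' \<in> homs K B P" "Comp K g' f = Comp K f' g"
    "\<forall>Q. \<forall>u\<in>homs K B Q. \<forall>v\<in>homs K X Q. Comp K u f = Comp K v g \<longrightarrow>
      (\<exists>!w. w \<in> homs K P Q \<and> Comp K w g' = u \<and> Comp K w f' = v)"
  using assms unfolding is_pushout_def homs_def by auto

end

context cofibration_category
begin

lemma Ident_W: "A \<in> Obj K \<Longrightarrow> Ident K A \<in> W"
proof -
  assume "A \<in> Obj K"
  then have "Ident K A \<in> homs K A A" by (rule Ident_homs)
  then have "is_iso K (Ident K A)"
    unfolding is_iso_def using Comp_Ident_right[of "Ident K A" A A]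
    by (intro conjI bexI[of _ "Ident K A"]) (simp_all add: homs_def)
  then show ?thesis using iso_acyclic_cofibration by blast
qed

text \<open>Two out of six for \<open>f\<close>, \<open>g\<close> and the identity of
  \<open>D\<close>.\<close>

lemma W_left_cancel:
  assumes "f \<in> homs K A B" "g \<in> homs K B D" "g \<in> W" "Comp K g f \<in> W"
  shows "f \<in> W"
  using two_out_of_six[OF assms(1,2) Ident_homs[of D]] assms
    homs_Obj[OF assms(2)] Comp_Ident_left[OF assms(2)] by auto

lemma W_right_cancel:
  assumes "f \<in> homs K A B" "g \<in> homs K B D" "f \<in> W" "Comp K g f \<in> W"
  shows "g \<in> W"
  using two_out_of_six[OF Ident_homs[of A] assms(1,2)] assms
    homs_Obj[OF assms(1)] Comp_Ident_right[OF assms(1)] by auto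

lemma cofibration_Comp_homs:
  "f \<in> homs K A B \<Longrightarrow> g \<in> homs K B D \<Longrightarrow> f \<in> C \<Longrightarrow> g \<in> C \<Longrightarrow> Comp K g f \<in> C"
  using cofibration_Comp by (simp add: homs_def)

lemma factorization_homs:
  assumes "f \<in> homs K A B"
  obtains Z c w where "c \<in> homs K A Z" "w \<in> homs K Z B" "c \<in> C" "w \<in> W" "f = Comp K w c"
  using factorization[of f] assms by (auto simp: homs_def)

text \<open>
  \<open>V\<close> is a cylinder of \<open>T\<close> in which the base points of the two copies of \<open>T\<close> (along
  \<open>f e\<close>) are identified, and \<open>V'\<close> is obtained from it by collapsing \<open>M\<close> in the second copy.
  The first copy of \<open>T\<close>, glued to the second copy of \<open>M\<close> along \<open>X\<close>, is an acyclic cofibration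
  into \<open>V\<close>, and \<open>V'\<close> is its cobase change along a retraction onto \<open>T\<close>.\<close>

lemma collapse_second_copy:
  assumes pushouts: "\<And>f g. f \<in> Arr K \<Longrightarrow> g \<in> Arr K \<Longrightarrow> Dom K f = Dom K g \<Longrightarrow>
      \<exists>f' g'. is_pushout K f g f' g'"
    and e: "e \<in> homs K X M" "e \<in> W \<inter> C"
    and p: "p \<in> homs K M X" "Comp K p e = Ident K X"
    and f: "f \<in> homs K M T" "f \<in> C"
  obtains V V' k1 k2 q v
  where "k1 \<in> homs K T V" "k2 \<in> homs K T V" "q \<in> homs K V T" "q \<in> W"
    "Comp K q k1 = Ident K T" "Comp K q k2 = Ident K T"
    "v \<in> homs K V V'" "Comp K v k1 \<in> W"
    "Comp K (Comp K v k2) f = Comp K (Comp K v k1) (Comp K f (Comp K e p))"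
proof -
  have id: "Ident K T \<in> homs K T T" "Ident K T \<in> W"
    using homs_Obj[OF f(1)] Ident_homs Ident_W by auto
  have fe: "Comp K f e \<in> homs K X T" using e f Comp_homs by blast
  have fep: "Comp K f (Comp K e p) \<in> homs K M T" using e f p Comp_homs by blast
  have "\<exists>i1 i2. is_pushout K e (Comp K f e) i1 i2"
    using e fe by (intro pushouts) (auto simp: homs_def)
  then obtain i1 i2 where poP: "is_pushout K e (Comp K f e) i1 i2" by blast
  obtain P where i1: "i1 \<in> homs K T P" and i2: "i2 \<in> homs K M P"
    and i: "Comp K i2 e = Comp K i1 (Comp K f e)"
    and uP: "\<forall>Q. \<forall>u\<in>homs K M Q. \<forall>v\<in>homs K T Q. Comp K u e = Comp K v (Comp K f e) \<longrightarrow>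
      (\<exists>!w. w \<in> homs K P Q \<and> Comp K w i2 = u \<and> Comp K w i1 = v)"
    by (rule is_pushout_homs[OF poP e(1) fe])
  have i1W: "i1 \<in> W" using cobase_change_acyclic_cofibration[OF e(2) poP] by simp
  \<comment> \<open>\<open>P\<close> is \<open>T\<close> with a second copy of \<open>M\<close>
    attached at the base point. Both \<open>d\<close> and \<open>g\<close> fix \<open>T\<close>:
    \<open>d\<close> folds the second copy onto \<open>T\<close> along \<open>f\<close>, and
    \<open>g\<close> collapses it to the base point.\<close>
  obtain d where d: "d \<in> homs K P T" "Comp K d i2 = f" "Comp K d i1 = Ident K T"
    using uP[rule_format, OF f(1) id(1)] Comp_Ident_left[OF fe] by auto
  obtain g where g: "g \<in> homs K P T" "Comp K g i2 = Comp K f (Comp K e p)"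
      "Comp K g i1 = Ident K T"
  proof -
    have "Comp K (Comp K f (Comp K e p)) e = Comp K (Ident K T) (Comp K f e)"
      using Comp_assoc[OF e(1) p(1) e(1)] Comp_assoc[OF e(1) Comp_homs[OF p(1) e(1)] f(1)]
        Comp_Ident_left[OF fe] Comp_Ident_right[OF e(1)] p(2) by simp
    then show ?thesis using uP[rule_format, OF fep id(1)] that by auto
  qed
  have "\<exists>s1 s2. is_pushout K f i2 s1 s2"
    using f i2 by (intro pushouts) (auto simp: homs_def)
  then obtain s1 s2 where poS: "is_pushout K f i2 s1 s2" by blast
  obtain S where s1: "s1 \<in> homs K P S" and s2: "s2 \<in> homs K T S"
    and s: "Comp K s2 f = Comp K s1 i2"
    and uS: "\<forall>Q. \<forall>u\<in>homs K T Q. \<forall>v\<in>homs K P Q. Comp K u f = Comp K v i2 \<longrightarrow>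
      (\<exists>!w. w \<in> homs K S Q \<and> Comp K w s2 = u \<and> Comp K w s1 = v)"
    by (rule is_pushout_homs[OF poS f(1) i2])
  have s1C: "s1 \<in> C" using cobase_change_cofibration[OF f(2) poS] .
  \<comment> \<open>\<open>S\<close> completes the second copy of \<open>M\<close> in
    \<open>P\<close> to a second copy of \<open>T\<close>. The fold \<open>h\<close> of the two
    copies is then factored, which makes them homotopic in \<open>V\<close>.\<close>
  obtain h where h: "h \<in> homs K S T" "Comp K h s2 = Ident K T" "Comp K h s1 = d"
    using uS[rule_format, OF id(1) d(1)] Comp_Ident_left[OF f(1)] d(2) by auto
  obtain V k q where k: "k \<in> homs K S V" "k \<in> C" and q: "q \<in> homs K V T" "q \<in> W"
    and qk: "h = Comp K q k"
    using factorization_homs[OF h(1)] by metis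
  define l where "l = Comp K k s1"
  have l: "l \<in> homs K P V" "l \<in> C"
    unfolding l_def using Comp_homs[OF s1 k(1)] cofibration_Comp_homs[OF s1 k(1) s1C k(2)] by auto
  define k1 where "k1 = Comp K l i1"
  define k2 where "k2 = Comp K k s2"
  have k1: "k1 \<in> homs K T V" and k2: "k2 \<in> homs K T V"
    unfolding k1_def k2_def using Comp_homs i1 l s2 k by blast+
  have ql: "Comp K q l = d"
    unfolding l_def using Comp_assoc[OF s1 k(1) q(1)] qk h by simp
  have qk1: "Comp K q k1 = Ident K T"
    unfolding k1_def using Comp_assoc[OF i1 l(1) q(1)] ql d by simp
  have qk2: "Comp K q k2 = Ident K T"
    unfolding k2_def using Comp_assoc[OF s2 k(1) q(1)] qk h by simp
  \<comment> \<open>A section of the equivalence \<open>q\<close> is an equivalence. Since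
    \<open>k1\<close> is \<open>l\<close> after the equivalence \<open>i1\<close>, also
    \<open>l\<close> is one, so its cobase change \<open>t\<close> along \<open>g\<close> is
    acyclic.\<close>
  have "k1 \<in> W" using W_left_cancel[OF k1 q(1,2)] qk1 id by simp
  then have lW: "l \<in> W" using W_right_cancel[OF i1 l(1) i1W] by (simp add: k1_def)
  have "\<exists>t v. is_pushout K l g t v"
    using l g by (intro pushouts) (auto simp: homs_def)
  then obtain t v where poV: "is_pushout K l g t v" by blast
  obtain V' where t: "t \<in> homs K T V'" and v: "v \<in> homs K V V'" and vl: "Comp K v l = Comp K t g"
    by (rule is_pushout_homs[OF poV l(1) g(1)]) blast
  have tW: "t \<in> W" using cobase_change_acyclic_cofibration[OF _ poV] lW l by simp
  have vk1: "Comp K v k1 = t"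
    unfolding k1_def using Comp_assoc[OF i1 l(1) v] vl Comp_assoc[OF i1 g(1) t] g
      Comp_Ident_right[OF t] by simp
  have "Comp K (Comp K v k2) f = Comp K v (Comp K k2 f)"
    using Comp_assoc[OF f(1) k2 v] by simp
  also have "Comp K k2 f = Comp K l i2"
    unfolding k2_def l_def using Comp_assoc[OF f(1) s2 k(1)] Comp_assoc[OF i2 s1 k(1)] s by simp
  also have "Comp K v (Comp K l i2) = Comp K t (Comp K f (Comp K e p))"
    using Comp_assoc[OF i2 l(1) v] vl Comp_assoc[OF i2 g(1) t] g by simp
  finally show ?thesis using that[OF k1 k2 q qk1 qk2 v] vk1 tW by simp
qed

end

section \<open>Pushouts of finite graphs\<close>

lemma graph_homs_iff:
  "m \<in> homs graph_category A B \<longleftrightarrow> finite_graph A \<and> finite_graph B \<and> src m = A \<and> tgt m = B \<and>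
     fn m \<in> extensional (verts A) \<and> graph_map A B (fn m)"
  by (auto simp: homs_def graph_category_def)

lemma fn_Comp:
  "m \<in> homs graph_category A B \<Longrightarrow> x \<in> verts A \<Longrightarrow> fn (Comp graph_category n m) x = fn n (fn m x)"
  by (simp add: graph_homs_iff) (simp add: graph_category_def compose_def)

lemma fn_Ident: "x \<in> verts A \<Longrightarrow> fn (Ident graph_category A) x = x"
  by (simp add: graph_category_def)

lemma graph_homs_eqI:
  assumes "m \<in> homs graph_category A B" "n \<in> homs graph_category A B"
    and "\<And>x. x \<in> verts A \<Longrightarrow> fn m x = fn n x"
  shows "m = n"
proof -
  have "fn m = fn n" using assms by (auto simp: graph_homs_iff intro: extensionalityI)
  then show ?thesis using assms by (simp add: graph_homs_iff)
qed

lemma graph_map_edge: "graph_map A B h \<Longrightarrow> finite_graph A \<Longrightarrow> {u, v} \<in> edges A \<Longrightarrow> {h u, h v} \<in> edges B"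
  unfolding graph_map_def finite_graph_def by (metis doubleton_eq_iff)

lemma graph_map_vert: "graph_map A B h \<Longrightarrow> u \<in> verts A \<Longrightarrow> h u \<in> verts B"
  unfolding graph_map_def by auto

lemma edge_verts: "finite_graph A \<Longrightarrow> {u, v} \<in> edges A \<Longrightarrow> u \<in> verts A \<and> v \<in> verts A"
  unfolding finite_graph_def by (metis doubleton_eq_iff)

lemma graph_hom_restrict:
  assumes "finite_graph A" "finite_graph B" "graph_map A B h"
  shows "\<lparr>src = A, tgt = B, fn = restrict h (verts A)\<rparr> \<in> homs graph_category A B"
  using assms by (auto simp: graph_homs_iff graph_map_def)

text \<open>A quotient of a finite set has finitely many classes, so it can be injected into the
  infinite type. This keeps quotient graphs among the objects.\<close>

lemma ex_classifying_map:
  fixes E :: "'b \<Rightarrow> 'b \<Rightarrow> bool"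
  assumes "finite U" "equivp E"
  shows "\<exists>p :: 'b \<Rightarrow> 'a::infinite. \<forall>s\<in>U. \<forall>t\<in>U. p s = p t \<longleftrightarrow> E s t"
proof -
  have "finite (Collect ` E ` U)" using assms by simp
  moreover obtain F :: "'a set" where "finite F" "card F = card (Collect ` E ` U)"
    using infinite_arbitrarily_large[OF infinite_UNIV] by blast
  ultimately obtain i :: "'b set \<Rightarrow> 'a" where i: "inj_on i (Collect ` E ` U)"
    by (metis bij_betw_imp_inj_on finite_same_card_bij)
  show ?thesis
  proof (intro exI[of _ "\<lambda>s. i (Collect (E s))"] ballI)
    fix s t assume "s \<in> U" "t \<in> U"
    then have "i (Collect (E s)) = i (Collect (E t)) \<longleftrightarrow> E s = E t"
      using inj_on_eq_iff[OF i, of "Collect (E s)" "Collect (E t)"] by (auto simp: Collect_inj)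
    then show "i (Collect (E s)) = i (Collect (E t)) \<longleftrightarrow> E s t"
      using assms(2) by (simp add: equivp_def)
  qed
qed

text \<open>The pushout is formed on vertices, as a quotient of the disjoint union, and its edges
  are exactly the images of edges of \<open>B\<close> and \<open>X\<close>. Hence a cocone of graph
  maps induces a graph map.\<close>

lemma graph_pushout_exists:
  fixes f g :: "'a::infinite graph_mor"
  assumes "f \<in> Arr graph_category" "g \<in> Arr graph_category"
    "Dom graph_category f = Dom graph_category g"
  shows "\<exists>f' g'. is_pushout graph_category f g f' g'"
proof -
  define A where "A = src f"
  define B where "B = tgt f"
  define X where "X = tgt g"
  have f: "f \<in> homs graph_category A B" and g: "g \<in> homs graph_category A X"
    using assms by (auto simp: homs_def A_def B_def X_def graph_category_def)
  have fin: "finite_graph A" "finite_graph B" "finite_graph X"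
    and fm: "graph_map A B (fn f)" and gm: "graph_map A X (fn g)"
    using f g by (auto simp: graph_homs_iff)
  define U where "U = Inl ` verts B \<union> Inr ` verts X"
  \<comment> \<open>Vertices are identified iff no compatible cocone separates them; cocones into the infinite
    type itself suffice, and the generated equivalence relation is never needed.\<close>
  define H where "H = {h :: 'a + 'a \<Rightarrow> 'a. \<forall>a\<in>verts A. h (Inl (fn f a)) = h (Inr (fn g a))}"
  define E where "E s t \<longleftrightarrow> (\<forall>h\<in>H. h s = h t)" for s t
  have "finite U" using fin by (simp add: U_def finite_graph_def)
  moreover have "equivp E"
    by (intro equivpI) (auto simp: reflp_def symp_def transp_def E_def)
  ultimately obtain p :: "'a + 'a \<Rightarrow> 'a" where p: "\<And>s t. s \<in> U \<Longrightarrow> t \<in> U \<Longrightarrow> p s = p t \<longleftrightarrow> E s t"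
    using ex_classifying_map[of U E] by blast
  have pfg: "p (Inl (fn f a)) = p (Inr (fn g a))" if "a \<in> verts A" for a
    using that graph_map_vert[OF fm that] graph_map_vert[OF gm that]
    by (subst p) (auto simp: U_def E_def H_def)
  define P where "P = \<lparr>verts = p ` U,
    edges = {{p (Inl u), p (Inl v)} | u v. {u, v} \<in> edges B} \<union>
            {{p (Inr u), p (Inr v)} | u v. {u, v} \<in> edges X}\<rparr>"
  have P: "finite_graph P"
    unfolding finite_graph_def
  proof (intro conjI ballI)
    show "finite (verts P)" using \<open>finite U\<close> by (simp add: P_def)
    fix e assume "e \<in> edges P"
    then consider u v where "e = {p (Inl u), p (Inl v)}" "{u, v} \<in> edges B"
      | u v where "e = {p (Inr u), p (Inr v)}" "{u, v} \<in> edges X"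
      by (auto simp: P_def)
    then show "\<exists>u\<in>verts P. \<exists>v\<in>verts P. e = {u, v}"
    proof cases
      case 1
      then show ?thesis using edge_verts[OF fin(2) 1(2)]
        by (intro bexI[of _ "p (Inl u)"] bexI[of _ "p (Inl v)"]) (auto simp: P_def U_def)
    next
      case 2
      then show ?thesis using edge_verts[OF fin(3) 2(2)]
        by (intro bexI[of _ "p (Inr u)"] bexI[of _ "p (Inr v)"]) (auto simp: P_def U_def)
    qed
  qed
  define g' where "g' = \<lparr>src = B, tgt = P, fn = restrict (p \<circ> Inl) (verts B)\<rparr>"
  define f' where "f' = \<lparr>src = X, tgt = P, fn = restrict (p \<circ> Inr) (verts X)\<rparr>"
  have g': "g' \<in> homs graph_category B P"
    unfolding g'_def by (rule graph_hom_restrict[OF fin(2) P]) (auto simp: graph_map_def P_def U_def)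
  have f': "f' \<in> homs graph_category X P"
    unfolding f'_def by (rule graph_hom_restrict[OF fin(3) P]) (auto simp: graph_map_def P_def U_def)
  have comm: "Comp graph_category g' f = Comp graph_category f' g"
  proof (rule graph_homs_eqI)
    show "Comp graph_category g' f \<in> homs graph_category A P"
      "Comp graph_category f' g \<in> homs graph_category A P"
      using f g f' g' category.Comp_homs[OF category_graph_category] by blast+
    show "fn (Comp graph_category g' f) x = fn (Comp graph_category f' g) x" if "x \<in> verts A" for x
      using that pfg graph_map_vert[OF fm that] graph_map_vert[OF gm that]
      by (simp add: fn_Comp[OF f] fn_Comp[OF g] f'_def g'_def)
  qed
  have univ: "\<exists>!w. w \<in> homs graph_category P Q \<and> Comp graph_category w g' = u \<and>
      Comp graph_category w f' = v"
    if u: "u \<in> homs graph_category B Q" and v: "v \<in> homs graph_category X Q"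
      and uv: "Comp graph_category u f = Comp graph_category v g" for Q u v
  proof -
    define h where "h = case_sum (fn u) (fn v)"
    have Q: "finite_graph Q" and um: "graph_map B Q (fn u)" and vm: "graph_map X Q (fn v)"
      using u v by (auto simp: graph_homs_iff)
    \<comment> \<open>The vertices of \<open>Q\<close> lie in the type used for \<open>H\<close>, so
      the cocone \<open>h\<close> itself belongs to \<open>H\<close> and respects
      \<open>E\<close>.\<close>
    have hE: "h s = h t" if "s \<in> U" "t \<in> U" "p s = p t" for s t
    proof -
      have "fn u (fn f a) = fn v (fn g a)" if "a \<in> verts A" for a
        using arg_cong[OF uv, of "\<lambda>m. fn m a"] fn_Comp[OF f that] fn_Comp[OF g that] by simp
      moreover have "E s t" using that p by blast
      ultimately show ?thesis unfolding E_def H_def h_def by simp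
    qed
    define w0 where "w0 = h \<circ> inv_into U p"
    have w0: "w0 (p s) = h s" if "s \<in> U" for s
      using hE[of "inv_into U p (p s)" s] that
      by (simp add: w0_def inv_into_into f_inv_into_f)
    have w0B: "w0 (p (Inl b)) = fn u b" if "b \<in> verts B" for b
      using that w0[of "Inl b"] by (simp add: U_def h_def)
    have w0X: "w0 (p (Inr b)) = fn v b" if "b \<in> verts X" for b
      using that w0[of "Inr b"] by (simp add: U_def h_def)
    have "graph_map P Q w0"
      unfolding graph_map_def
    proof (intro conjI ballI impI)
      show "w0 \<in> verts P \<rightarrow> verts Q"
        using graph_map_vert[OF um] graph_map_vert[OF vm] w0B w0X
        by (auto simp: P_def U_def)
      fix a b assume "{a, b} \<in> edges P"
      then consider s t where "{a, b} = {p (Inl s), p (Inl t)}" "{s, t} \<in> edges B"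
        | s t where "{a, b} = {p (Inr s), p (Inr t)}" "{s, t} \<in> edges X"
        by (auto simp: P_def)
      then show "{w0 a, w0 b} \<in> edges Q"
      proof cases
        case 1
        then have "w0 ` {a, b} = {fn u s, fn u t}"
          using edge_verts[OF fin(2) 1(2)] w0B by simp
        then show ?thesis using graph_map_edge[OF um fin(2) 1(2)] by simp
      next
        case 2
        then have "w0 ` {a, b} = {fn v s, fn v t}"
          using edge_verts[OF fin(3) 2(2)] w0X by simp
        then show ?thesis using graph_map_edge[OF vm fin(3) 2(2)] by simp
      qed
    qed
    then have w: "\<lparr>src = P, tgt = Q, fn = restrict w0 (verts P)\<rparr> \<in> homs graph_category P Q"
      (is "?w \<in> _") using P Q graph_hom_restrict by blast
    have vP: "p (Inl b) \<in> verts P" if "b \<in> verts B" for b using that by (simp add: P_def U_def)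
    have vP': "p (Inr b) \<in> verts P" if "b \<in> verts X" for b using that by (simp add: P_def U_def)
    show ?thesis
    proof (rule ex1I[of _ ?w], intro conjI)
      show "?w \<in> homs graph_category P Q" by (rule w)
      show "Comp graph_category ?w g' = u"
      proof (rule graph_homs_eqI[OF _ u])
        show "Comp graph_category ?w g' \<in> homs graph_category B Q"
          using w g' category.Comp_homs[OF category_graph_category] by blast
      qed (simp add: fn_Comp[OF g'], simp add: g'_def w0B vP)
      show "Comp graph_category ?w f' = v"
      proof (rule graph_homs_eqI[OF _ v])
        show "Comp graph_category ?w f' \<in> homs graph_category X Q"
          using w f' category.Comp_homs[OF category_graph_category] by blast
      qed (simp add: fn_Comp[OF f'], simp add: f'_def w0X vP')
    next
      fix w' assume w': "w' \<in> homs graph_category P Q \<and> Comp graph_category w' g' = u \<and>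
        Comp graph_category w' f' = v"
      show "w' = ?w"
      proof (rule graph_homs_eqI[OF _ w])
        show "w' \<in> homs graph_category P Q" using w' by simp
        fix y assume y: "y \<in> verts P"
        then consider b where "b \<in> verts B" "y = p (Inl b)" | b where "b \<in> verts X" "y = p (Inr b)"
          by (auto simp: P_def U_def)
        then show "fn w' y = fn ?w y"
        proof cases
          case 1
          then show ?thesis using fn_Comp[OF g' 1(1), of w'] w' w0B y by (simp add: g'_def)
        next
          case 2
          then show ?thesis using fn_Comp[OF f' 2(1), of w'] w' w0X y by (simp add: f'_def)
        qed
      qed
    qed
  qed
  have "is_pushout graph_category f g f' g'"
    unfolding is_pushout_def
    using f g f' g' comm univ unfolding homs_def by auto
  then show ?thesis by blast
qed

lemma homs_graph_map:
  "m \<in> homs graph_category A B \<Longrightarrow> graph_map A B (fn m) \<and> finite_graph A \<and> finite_graph B"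
  by (simp add: graph_homs_iff)

lemma fn_edge: "m \<in> homs graph_category A B \<Longrightarrow> {u, v} \<in> edges A \<Longrightarrow> {fn m u, fn m v} \<in> edges B"
  using homs_graph_map[of m A B] graph_map_edge[of A B "fn m"] by simp

lemma fn_loop: "m \<in> homs graph_category A B \<Longrightarrow> {u} \<in> edges A \<Longrightarrow> {fn m u} \<in> edges B"
  using fn_edge[of m A B u u] by simp

lemma fn_vert: "m \<in> homs graph_category A B \<Longrightarrow> u \<in> verts A \<Longrightarrow> fn m u \<in> verts B"
  using homs_graph_map[of m A B] graph_map_vert[of A B "fn m"] by simp

definition constant_mor :: "'a graph \<Rightarrow> 'a graph \<Rightarrow> 'a \<Rightarrow> 'a graph_mor" where
  "constant_mor A B b = \<lparr>src = A, tgt = B, fn = (\<lambda>x\<in>verts A. b)\<rparr>"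

lemma constant_mor_homs:
  assumes "finite_graph A" "finite_graph B" "{b} \<in> edges B"
  shows "constant_mor A B b \<in> homs graph_category A B"
  using assms edge_verts[of B b b]
  by (auto simp: constant_mor_def intro!: graph_hom_restrict simp: graph_map_def)

lemma fn_constant_mor: "x \<in> verts A \<Longrightarrow> fn (constant_mor A B b) x = b"
  by (simp add: constant_mor_def)

section \<open>Reflexive walks and homotopies\<close>

text \<open>Adjacency in the reflexive subgraph on the looped vertices; a looped vertex moves inside
  it during a homotopy.\<close>

definition looped_adj :: "'a graph \<Rightarrow> 'a rel" where
  "looped_adj G = {(u, v). {u} \<in> edges G \<and> {v} \<in> edges G \<and> {u, v} \<in> edges G}"

lemma looped_adj_map:
  assumes "graph_map A B h" "finite_graph A" "(u, v) \<in> looped_adj A"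
  shows "(h u, h v) \<in> looped_adj B"
  using assms graph_map_edge[OF assms(1,2), of u v] graph_map_edge[OF assms(1,2), of u u]
    graph_map_edge[OF assms(1,2), of v v] by (simp add: looped_adj_def)

lemma looped_adj_rtrancl_sym: "(u, v) \<in> (looped_adj G)\<^sup>* \<Longrightarrow> (v, u) \<in> (looped_adj G)\<^sup>*"
  by (rule symD[OF sym_rtrancl]) (auto simp: sym_def looped_adj_def insert_commute)

lemma homotopy_edge:
  assumes "graph_map (graph_prod A (interval_graph n)) B F" "finite_graph A" "{a, b} \<in> edges A"
    "i \<le> n" "j \<le> n" "\<bar>int i - int j\<bar> \<le> 1"
  shows "{F (a, i), F (b, j)} \<in> edges B"
proof -
  have "{(a, i), (b, j)} \<in> edges (graph_prod A (interval_graph n))"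
    unfolding graph_prod_def graph.simps mem_Collect_eq
    using assms(3-) by (intro exI[of _ a] exI[of _ i] exI[of _ b] exI[of _ j])
      (auto simp: interval_graph_def)
  moreover have "(a, i) \<in> verts (graph_prod A (interval_graph n))"
    "(b, j) \<in> verts (graph_prod A (interval_graph n))"
    using edge_verts[OF assms(2,3)] assms(4,5) by (auto simp: graph_prod_def interval_graph_def)
  ultimately show ?thesis using assms(1) unfolding graph_map_def by blast
qed

text \<open>The loop at \<open>a\<close> gives loops at all \<open>(a, j)\<close> and edges from
  \<open>(a, j)\<close> to \<open>(a, Suc j)\<close>, so the homotopy itself traces the
  walk.\<close>

lemma times_homotopic_track:
  assumes "times_homotopic A B f g" "finite_graph A" "{a} \<in> edges A"
  shows "(f a, g a) \<in> (looped_adj B)\<^sup>*"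
proof -
  obtain n F where F: "graph_map (graph_prod A (interval_graph n)) B F"
    and ends: "\<forall>a\<in>verts A. F (a, 0) = f a \<and> F (a, n) = g a"
    using assms(1) unfolding times_homotopic_def by blast
  have a: "{a, a} \<in> edges A" using assms(3) by simp
  have track: "j \<le> n \<Longrightarrow> (F (a, 0), F (a, j)) \<in> (looped_adj B)\<^sup>*" for j
  proof (induction j)
    case (Suc j)
    then have "(F (a, j), F (a, Suc j)) \<in> looped_adj B"
      using homotopy_edge[OF F assms(2) a, of j "Suc j"] homotopy_edge[OF F assms(2) a, of j j]
        homotopy_edge[OF F assms(2) a, of "Suc j" "Suc j"] by (simp add: looped_adj_def)
    with Suc show ?case by (auto intro: rtrancl_into_rtrancl)
  qed simp
  then show ?thesis using ends edge_verts[OF assms(2) a] track[of n] by simp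
qed

lemma times_equivalenceE:
  assumes "m \<in> times_equivalences" "m \<in> homs graph_category A B"
  obtains g where "graph_map B A g" "times_homotopic A A (g \<circ> fn m) id"
    "times_homotopic B B (fn m \<circ> g) id"
  using assms by (auto simp: times_equivalences_def times_homotopy_equivalence_def graph_homs_iff)

lemma times_equivalenceI:
  assumes "m \<in> homs graph_category A B" "graph_map B A g" "times_homotopic A A (g \<circ> fn m) id"
    "times_homotopic B B (fn m \<circ> g) id"
  shows "m \<in> times_equivalences"
proof -
  have "src m = A" "tgt m = B" "m \<in> Arr graph_category" "graph_map A B (fn m)"
    using assms(1) assms(1)[unfolded graph_homs_iff] by (auto simp: homs_def)
  then show ?thesis
    using assms(2-) by (auto simp: times_equivalences_def times_homotopy_equivalence_def)
qed

text \<open>A homotopy inverse carries the walk back to \<open>A\<close>; the tracks of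
  \<open>a\<close> and \<open>b\<close> under the homotopy to the identity correct its ends.\<close>

lemma times_equivalence_connected:
  assumes "m \<in> times_equivalences" "m \<in> homs graph_category A B"
    and "{a} \<in> edges A" "{b} \<in> edges A" "(fn m a, fn m b) \<in> (looped_adj B)\<^sup>*"
  shows "(a, b) \<in> (looped_adj A)\<^sup>*"
proof -
  obtain g where g: "graph_map B A g" "times_homotopic A A (g \<circ> fn m) id"
    using times_equivalenceE[OF assms(1,2)] by metis
  have fin: "finite_graph A" "finite_graph B" using assms(2) by (auto simp: graph_homs_iff)
  have "(g (fn m a), g (fn m b)) \<in> (looped_adj A)\<^sup>*"
    using assms(5)
  proof (induction rule: rtrancl_induct)
    case (step s t)
    then show ?case using looped_adj_map[OF g(1) fin(2)] by (meson rtrancl.rtrancl_into_rtrancl)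
  qed simp
  moreover have "(g (fn m a), a) \<in> (looped_adj A)\<^sup>*" "(g (fn m b), b) \<in> (looped_adj A)\<^sup>*"
    using times_homotopic_track[OF g(2) fin(1)] assms(3,4) by fastforce+
  ultimately show ?thesis by (meson looped_adj_rtrancl_sym rtrancl_trans)
qed

lemma looped_walkE:
  assumes "(u, v) \<in> (looped_adj G)\<^sup>*"
  obtains N c where "c 0 = u" "c N = v" "\<forall>i<N. (c i, c (Suc i)) \<in> looped_adj G"
  using assms by (auto simp: rtrancl_power relpow_fun_conv)

section \<open>Winding numbers\<close>

text \<open>The residue of \<open>j - i\<close> modulo \<open>n\<close> in \<open>{-1..n - 2}\<close>.\<close>

definition cyclic_step :: "int \<Rightarrow> int \<Rightarrow> int \<Rightarrow> int" where
  "cyclic_step n i j = (j - i + 1) mod n - 1"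

text \<open>The total displacement of a lift to the integers: one full turn counts
  \<open>n\<close>.\<close>

definition winding :: "int \<Rightarrow> (nat \<Rightarrow> int) \<Rightarrow> nat \<Rightarrow> int" where
  "winding n c N = (\<Sum>i<N. cyclic_step n (c i) (c (Suc i)))"

lemma cyclic_step_same: "n > 1 \<Longrightarrow> cyclic_step n i i = 0"
  by (simp add: cyclic_step_def)

text \<open>For \<open>n > 2\<close> the residues \<open>-1\<close>, \<open>0\<close> and
  \<open>1\<close> all lie in the window from \<open>-1\<close> to \<open>n - 2\<close>, so short
  steps are recovered exactly.\<close>

lemma cyclic_step_mod:
  assumes "n > 2" "\<bar>i - j\<bar> \<le> 1"
  shows "cyclic_step n (i mod n) (j mod n) = j - i"
proof -
  have "(j mod n - i mod n + 1) mod n = (j - i + 1) mod n"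
    by (metis mod_add_left_eq mod_diff_eq)
  then show ?thesis using assms by (simp add: cyclic_step_def)
qed

lemma cyclic_step_dvd: "n dvd cyclic_step n i j - (j - i)"
proof -
  have "cyclic_step n i j - (j - i) = (j - i + 1) mod n - (j - i + 1)"
    by (simp add: cyclic_step_def)
  then show ?thesis by (metis dvd_minus_mod dvd_diff_commute)
qed

text \<open>Both sums are congruent to \<open>d - a\<close> modulo \<open>n\<close> and differ by at
  most 4, so they agree once \<open>n\<close> is at least 5.\<close>

lemma cyclic_step_square:
  assumes "n \<ge> 5" "\<bar>cyclic_step n a b\<bar> \<le> 1" "\<bar>cyclic_step n b d\<bar> \<le> 1"
    "\<bar>cyclic_step n a c\<bar> \<le> 1" "\<bar>cyclic_step n c d\<bar> \<le> 1"
  shows "cyclic_step n a b + cyclic_step n b d = cyclic_step n a c + cyclic_step n c d"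
proof -
  let ?s = "cyclic_step n"
  have "n dvd ((?s a b - (b - a)) + (?s b d - (d - b))) - ((?s a c - (c - a)) + (?s c d - (d - c)))"
    by (intro dvd_diff dvd_add cyclic_step_dvd)
  then have "n dvd (?s a b + ?s b d) - (?s a c + ?s c d)" by (simp add: algebra_simps)
  moreover have "\<bar>(?s a b + ?s b d) - (?s a c + ?s c d)\<bar> < n" using assms by linarith
  ultimately show ?thesis using dvd_imp_le_int[of "(?s a b + ?s b d) - (?s a c + ?s c d)" n] assms(1)
    by linarith
qed

lemma winding_bound:
  assumes "\<And>i. i < N \<Longrightarrow> \<bar>cyclic_step n (c i) (c (Suc i))\<bar> \<le> 1"
  shows "\<bar>winding n c N\<bar> \<le> int N"
proof -
  have "\<bar>winding n c N\<bar> \<le> (\<Sum>i<N. \<bar>cyclic_step n (c i) (c (Suc i))\<bar>)"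
    unfolding winding_def by (rule sum_abs)
  also have "\<dots> \<le> of_nat (card {..<N}) * 1"
    by (rule sum_bounded_above) (use assms in auto)
  finally show ?thesis by simp
qed

lemma winding_concat:
  assumes "c N = d 0"
  shows "winding n (\<lambda>i. if i < N then c i else d (i - N)) (N + L) = winding n c N + winding n d L"
proof (induction L)
  case 0
  have "winding n (\<lambda>i. if i < N then c i else d (i - N)) N = winding n c N"
    unfolding winding_def
  proof (rule sum.cong)
    fix i assume "i \<in> {..<N}"
    then show "cyclic_step n (if i < N then c i else d (i - N))
        (if Suc i < N then c (Suc i) else d (Suc i - N)) = cyclic_step n (c i) (c (Suc i))"
      using assms by (cases "Suc i = N") auto
  qed simp
  then show ?case by (simp add: winding_def)
next
  case (Suc L)
  then show ?case by (simp add: winding_def Suc_diff_le)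
qed

text \<open>For \<open>n > 2\<close> this encodes a graph map to the reflexive
  \<open>n\<close>-cycle by integer representatives of residues.\<close>

definition cyclic_labelling :: "int \<Rightarrow> 'a graph \<Rightarrow> ('a \<Rightarrow> int) \<Rightarrow> bool" where
  "cyclic_labelling n G l \<longleftrightarrow> (\<forall>u v. {u, v} \<in> edges G \<longrightarrow> \<bar>cyclic_step n (l u) (l v)\<bar> \<le> 1)"

lemma cyclic_labelling_comp:
  "cyclic_labelling n B l \<Longrightarrow> graph_map A B h \<Longrightarrow> finite_graph A \<Longrightarrow> cyclic_labelling n A (l \<circ> h)"
  using graph_map_edge by (fastforce simp: cyclic_labelling_def)

definition closed_looped_walk :: "'a graph \<Rightarrow> nat \<Rightarrow> (nat \<Rightarrow> 'a) \<Rightarrow> bool" where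
  "closed_looped_walk G N c \<longleftrightarrow> c N = c 0 \<and> (\<forall>i<N. (c i, c (Suc i)) \<in> looped_adj G)"

lemma closed_looped_walk_map:
  "closed_looped_walk A N c \<Longrightarrow> graph_map A B h \<Longrightarrow> finite_graph A \<Longrightarrow> closed_looped_walk B N (h \<circ> c)"
  using looped_adj_map by (fastforce simp: closed_looped_walk_def)

text \<open>The homotopy sweeps the walk over a grid of squares, handled by
  \<open>cyclic_step_square\<close>. As the walk is closed, the two vertical sides of the grid
  coincide and cancel.\<close>

lemma winding_homotopy_invariant:
  assumes "times_homotopic A B f g" "finite_graph A" "n \<ge> 5" "cyclic_labelling n B l"
    "closed_looped_walk A N c"
  shows "winding n (l \<circ> f \<circ> c) N = winding n (l \<circ> g \<circ> c) N"
\<comment> \<open>For \<open>N = 0\<close> nothing places \<open>c 0\<close> in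
  \<open>verts A\<close>, but both sums are empty.\<close>
proof (cases "N = 0")
  case False
  obtain k F where F: "graph_map (graph_prod A (interval_graph k)) B F"
    and ends: "\<forall>a\<in>verts A. F (a, 0) = f a \<and> F (a, k) = g a"
    using assms(1) unfolding times_homotopic_def by blast
  have walk: "{c i} \<in> edges A" "{c (Suc i)} \<in> edges A" "{c i, c (Suc i)} \<in> edges A" if "i < N" for i
    using assms(5) that by (auto simp: closed_looped_walk_def looped_adj_def)
  have closed: "c N = c 0" using assms(5) by (simp add: closed_looped_walk_def)
  have cv: "c i \<in> verts A" if "i \<le> N" for i
  proof (cases "i = N")
    case True
    then show ?thesis using closed walk(1)[of 0] edge_verts[OF assms(2), of "c 0" "c 0"] False by simp
  next
    case False
    then show ?thesis using walk(1)[of i] edge_verts[OF assms(2), of "c i" "c i"] that by simp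
  qed
  define h where "h j i = l (F (c i, j))" for j i
  have step: "\<bar>cyclic_step n (h j i) (h j' i')\<bar> \<le> 1"
    if "{c i, c i'} \<in> edges A" "j \<le> k" "j' \<le> k" "\<bar>int j - int j'\<bar> \<le> 1" for i i' j j'
    using homotopy_edge[OF F assms(2) that] assms(4) by (simp add: cyclic_labelling_def h_def)
  \<comment> \<open>The squares between the levels \<open>j\<close> and \<open>j + 1\<close> of the homotopy commute, so that the
    difference of the two sums telescopes.\<close>
  have one: "winding n (h j) N = winding n (h (Suc j)) N" if "Suc j \<le> k" for j
  proof -
    have sq: "cyclic_step n (h j i) (h j (Suc i)) - cyclic_step n (h (Suc j) i) (h (Suc j) (Suc i))
      = cyclic_step n (h j i) (h (Suc j) i) - cyclic_step n (h j (Suc i)) (h (Suc j) (Suc i))"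
      if "i < N" for i
      using cyclic_step_square[OF assms(3), of "h j i" "h j (Suc i)" "h (Suc j) (Suc i)" "h (Suc j) i"]
        step[of i "Suc i" j j] step[of "Suc i" "Suc i" j "Suc j"] step[of i i j "Suc j"]
        step[of i "Suc i" "Suc j" "Suc j"] walk[OF that] \<open>Suc j \<le> k\<close> by simp
    have "winding n (h j) N - winding n (h (Suc j)) N =
      (\<Sum>i<N. cyclic_step n (h j i) (h (Suc j) i) - cyclic_step n (h j (Suc i)) (h (Suc j) (Suc i)))"
      unfolding winding_def sum_subtractf[symmetric] by (rule sum.cong) (use sq in auto)
    also have "\<dots> = cyclic_step n (h j 0) (h (Suc j) 0) - cyclic_step n (h j N) (h (Suc j) N)"
      by (rule sum_lessThan_telescope')
    also have "\<dots> = 0" using closed by (simp add: h_def)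
    finally show ?thesis by simp
  qed
  have "j \<le> k \<Longrightarrow> winding n (h 0) N = winding n (h j) N" for j
    by (induction j) (use one in auto)
  from this[of k] have "winding n (h 0) N = winding n (h k) N" by simp
  moreover have "winding n (h 0) N = winding n (l \<circ> f \<circ> c) N"
    "winding n (h k) N = winding n (l \<circ> g \<circ> c) N"
    unfolding winding_def by (rule sum.cong; use ends cv in \<open>auto simp: h_def\<close>)+
  ultimately show ?thesis by simp
qed (simp add: winding_def)

section \<open>Graphs on initial segments of the natural numbers\<close>

text \<open>A fixed copy of the naturals in the vertex type, so that concrete paths and cycles
  become objects.\<close>

definition numbering :: "nat \<Rightarrow> 'a::infinite" where
  "numbering = (SOME h. inj h)"

lemma inj_numbering: "inj (numbering :: nat \<Rightarrow> 'a::infinite)"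
proof -
  obtain h :: "nat \<Rightarrow> 'a" where "inj h"
    using infinite_countable_subset[OF infinite_UNIV] by metis
  then show ?thesis unfolding numbering_def by (rule someI[of inj])
qed

definition number :: "'a::infinite \<Rightarrow> nat" where
  "number = inv numbering"

lemma number_numbering [simp]: "number (numbering i) = i"
  by (simp add: number_def inj_numbering)

lemma numbering_eq_iff [simp]: "numbering i = numbering j \<longleftrightarrow> i = j"
  using inj_numbering by (auto simp: inj_def)

text \<open>Edges are unordered, so \<open>r\<close> is imposed in both directions; this makes
  \<open>edge_numbered_graph_iff\<close> hold for arbitrary \<open>r\<close>.\<close>

definition numbered_graph :: "nat \<Rightarrow> (nat \<Rightarrow> nat \<Rightarrow> bool) \<Rightarrow> 'a::infinite graph" where
  "numbered_graph k r = \<lparr>verts = numbering ` {..<k},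
     edges = {{numbering i, numbering j} | i j. i < k \<and> j < k \<and> r i j \<and> r j i}\<rparr>"

lemma verts_numbered_graph: "verts (numbered_graph k r) = numbering ` {..<k}"
  by (simp add: numbered_graph_def)

lemma edge_numbered_graph_iff:
  "{u, v} \<in> edges (numbered_graph k r) \<longleftrightarrow>
    (\<exists>i j. u = numbering i \<and> v = numbering j \<and> i < k \<and> j < k \<and> r i j \<and> r j i)"
  by (auto simp: numbered_graph_def doubleton_eq_iff)

lemma edge_numbered_graphI:
  "i < k \<Longrightarrow> j < k \<Longrightarrow> r i j \<Longrightarrow> r j i \<Longrightarrow> {numbering i, numbering j} \<in> edges (numbered_graph k r)"
  by (simp add: edge_numbered_graph_iff)

lemma loop_numbered_graph: "i < k \<Longrightarrow> r i i \<Longrightarrow> {numbering i} \<in> edges (numbered_graph k r)"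
  using edge_numbered_graphI[of i k i r] by simp

lemma finite_numbered_graph: "finite_graph (numbered_graph k r)"
  by (auto simp: finite_graph_def numbered_graph_def)

abbreviation "point_graph \<equiv> numbered_graph (Suc 0) (\<lambda>_ _. True)"
abbreviation "path_graph n \<equiv> numbered_graph (Suc n) (\<lambda>i j. \<bar>int i - int j\<bar> \<le> 1)"
abbreviation "cycle_graph n \<equiv> numbered_graph n (\<lambda>i j. \<bar>cyclic_step (int n) (int i) (int j)\<bar> \<le> 1)"

lemma loop_point_graph: "{numbering 0} \<in> edges point_graph"
  by (rule loop_numbered_graph) simp_all

lemma loop_path_graph: "i \<le> n \<Longrightarrow> {numbering i} \<in> edges (path_graph n)"
  by (rule loop_numbered_graph) simp_all

lemma loop_cycle_graph: "n > 1 \<Longrightarrow> {numbering 0} \<in> edges (cycle_graph n)"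
  by (rule loop_numbered_graph) (simp_all add: cyclic_step_same)

lemma path_graph_connected:
  "j \<le> n \<Longrightarrow> (numbering 0, numbering j) \<in> (looped_adj (path_graph n :: 'a::infinite graph))\<^sup>*"
proof (induction j)
  case (Suc j)
  then have "(numbering j, numbering (Suc j)) \<in> looped_adj (path_graph n :: 'a graph)"
    using loop_path_graph[of j n] loop_path_graph[of "Suc j" n]
      edge_numbered_graphI[of j "Suc n" "Suc j" "\<lambda>i j. \<bar>int i - int j\<bar> \<le> 1"]
    by (simp add: looped_adj_def)
  with Suc show ?case by (auto intro: rtrancl_into_rtrancl)
qed simp

lemma path_graph_contractible:
  "constant_mor point_graph (path_graph n) (numbering 0) \<in> (times_equivalences :: 'a::infinite graph_mor set)"
    (is "?z \<in> _")
proof -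
  let ?P = "path_graph n :: 'a graph" and ?I = "point_graph :: 'a graph"
  have z: "?z \<in> homs graph_category ?I ?P"
    by (rule constant_mor_homs[OF finite_numbered_graph finite_numbered_graph loop_path_graph]) simp
  have "graph_map ?P ?I (\<lambda>_. numbering 0)"
    using loop_point_graph by (auto simp: graph_map_def verts_numbered_graph)
  moreover have "times_homotopic ?I ?I ((\<lambda>_. numbering 0) \<circ> fn ?z) id"
    unfolding times_homotopic_def
  proof (intro exI conjI)
    show "graph_map (graph_prod ?I (interval_graph 0)) ?I (\<lambda>_. numbering 0)"
      using loop_point_graph by (auto simp: graph_map_def verts_numbered_graph)
  qed (auto simp: verts_numbered_graph)
  moreover have "times_homotopic ?P ?P (fn ?z \<circ> (\<lambda>_. numbering 0)) id"
    unfolding times_homotopic_def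
  proof (intro exI conjI)
    \<comment> \<open>At time \<open>t\<close> the path is truncated at \<open>t\<close>: constant
      at time 0, the identity at time \<open>n\<close>.\<close>
    let ?F = "\<lambda>(u :: 'a, t). numbering (min (number u) t) :: 'a"
    show "graph_map (graph_prod ?P (interval_graph n)) ?P ?F"
      unfolding graph_map_def
    proof (intro conjI ballI impI)
      show "?F \<in> verts (graph_prod ?P (interval_graph n)) \<rightarrow> verts ?P"
        by (auto simp: graph_prod_def verts_numbered_graph)
      fix s t assume "{s, t} \<in> edges (graph_prod ?P (interval_graph n))"
      then obtain u a v b where st: "s = (u, a)" "t = (v, b)" "{u, v} \<in> edges ?P"
        "{a, b} \<in> edges (interval_graph n)"
        by (auto simp: graph_prod_def doubleton_eq_iff insert_commute)
      then show "{?F s, ?F t} \<in> edges ?P"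
        by (auto simp: edge_numbered_graph_iff interval_graph_def doubleton_eq_iff)
    qed
    show "\<forall>a\<in>verts ?P. ?F (a, 0) = (fn ?z \<circ> (\<lambda>_. numbering 0)) a \<and> ?F (a, n) = id a"
      by (auto simp: verts_numbered_graph fn_constant_mor)
  qed
  ultimately show ?thesis
    by (rule times_equivalenceI[OF z])
qed

text \<open>Both ends \<open>0\<close> and \<open>n\<close> of the path go to \<open>0\<close>, so a
  walk between them becomes closed.\<close>

lemma wrap_path_graph:
  assumes "n > 2"
  shows "graph_map (path_graph n) (cycle_graph n) (\<lambda>u. numbering (number u mod n))"
  unfolding graph_map_def
proof (intro conjI ballI impI)
  show "(\<lambda>u. numbering (number u mod n)) \<in> verts (path_graph n) \<rightarrow> verts (cycle_graph n)"
    using assms by (auto simp: verts_numbered_graph)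
  fix u v assume "{u, v} \<in> edges (path_graph n)"
  then obtain i j where "u = numbering i" "v = numbering j" "\<bar>int i - int j\<bar> \<le> 1" "\<bar>int j - int i\<bar> \<le> 1"
    by (auto simp: edge_numbered_graph_iff)
  then show "{numbering (number u mod n), numbering (number v mod n)} \<in> edges (cycle_graph n)"
    using assms by (auto simp: edge_numbered_graph_iff zmod_int cyclic_step_mod)
qed

lemma cyclic_labelling_number: "cyclic_labelling (int n) (cycle_graph n) (int \<circ> number)"
  by (auto simp: cyclic_labelling_def edge_numbered_graph_iff)

text \<open>Each cyclic step equals the difference of the unreduced positions, and these telescope
  from \<open>0\<close> to \<open>n\<close>.\<close>

lemma winding_wrapped_walk:
  assumes "n > 2" "c 0 = numbering 0" "c N = numbering n"
    and "\<And>i. i < N \<Longrightarrow> {c i, c (Suc i)} \<in> edges (path_graph n)"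
  shows "winding (int n) (\<lambda>i. int (number (c i) mod n)) N = int n"
proof -
  have "cyclic_step (int n) (int (number (c i) mod n)) (int (number (c (Suc i)) mod n)) =
      int (number (c (Suc i))) - int (number (c i))" if "i < N" for i
  proof -
    from assms(4)[OF that] have "\<bar>int (number (c i)) - int (number (c (Suc i)))\<bar> \<le> 1"
      by (auto simp: edge_numbered_graph_iff)
    then show ?thesis using assms(1) by (simp add: zmod_int cyclic_step_mod)
  qed
  then have "winding (int n) (\<lambda>i. int (number (c i) mod n)) N =
      (\<Sum>i<N. int (number (c (Suc i))) - int (number (c i)))"
    unfolding winding_def by (intro sum.cong) auto
  also have "\<dots> = int n" using sum_lessThan_telescope[of "\<lambda>i. int (number (c i))" N] assms(2,3) by simp
  finally show ?thesis .
qed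

section \<open>There is no cofibration category structure\<close>

lemma is_initial_empty_graph: "is_initial graph_category \<lparr>verts = {}, edges = {}\<rparr>"
proof -
  let ?E = "\<lparr>verts = {}, edges = {}\<rparr> :: 'a graph"
  have E: "finite_graph ?E" by (simp add: finite_graph_def)
  show ?thesis
    unfolding is_initial_def
  proof (intro conjI ballI)
    show "?E \<in> Obj graph_category" using E by (simp add: graph_category_def)
    fix X :: "'a graph" assume "X \<in> Obj graph_category"
    then have h: "\<lparr>src = ?E, tgt = X, fn = restrict id (verts ?E)\<rparr> \<in> homs graph_category ?E X"
      using E by (intro graph_hom_restrict) (auto simp: graph_category_def graph_map_def)
    show "\<exists>!f. f \<in> homs graph_category ?E X"
    proof (rule ex1I)
      show "f = \<lparr>src = ?E, tgt = X, fn = restrict id (verts ?E)\<rparr>" if "f \<in> homs graph_category ?E X" for f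
        by (rule graph_homs_eqI[OF that h]) simp
    qed (rule h)
  qed
qed

theorem no_cofibration_category:
  fixes C :: "'a::infinite graph_mor set"
  shows "\<not> cofibration_category graph_category times_equivalences C"
proof
  assume "cofibration_category graph_category times_equivalences C"
  then interpret cofibration_category "graph_category :: ('a graph, 'a graph_mor) cat"
    times_equivalences C .
  let ?K = "graph_category :: ('a graph, 'a graph_mor) cat"
  let ?I = "point_graph :: 'a graph" and ?E = "\<lparr>verts = {}, edges = {}\<rparr> :: 'a graph"
  let ?o = "numbering 0 :: 'a"

  \<comment> \<open>The looped point and its coproduct with itself\<close>
  have I: "finite_graph ?I" "{?o} \<in> edges ?I" "?o \<in> verts ?I" "\<And>x. x \<in> verts ?I \<Longrightarrow> x = ?o"
    using finite_numbered_graph loop_point_graph by (auto simp: verts_numbered_graph)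
  have point: "constant_mor ?I G b \<in> homs ?K ?I G" if "finite_graph G" "{b} \<in> edges G" for G b
    using constant_mor_homs[OF I(1) that] .
  have fnp: "fn (constant_mor ?I G b) ?o = b" for G b
    using fn_constant_mor I(3) by metis
  have point_eq: "s = t" if "s \<in> homs ?K ?I G" "t \<in> homs ?K ?I G" "fn s ?o = fn t ?o" for s t G
    using graph_homs_eqI[OF that(1,2)] I(4) that(3) by metis
  have "?I \<in> Obj ?K" using I(1) by (simp add: graph_category_def)
  then obtain \<iota> where \<iota>: "\<iota> \<in> homs ?K ?E ?I"
    using is_initial_empty_graph[where 'a = 'a] unfolding is_initial_def by blast
  have \<iota>C: "\<iota> \<in> C" using all_cofibrant[OF is_initial_empty_graph \<open>?I \<in> Obj ?K\<close> \<iota>] .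
  have "\<exists>j1 j2. is_pushout ?K \<iota> \<iota> j1 j2"
    using \<iota> by (intro graph_pushout_exists) (auto simp: homs_def)
  then obtain j1 j2 where poJ: "is_pushout ?K \<iota> \<iota> j1 j2" by blast
  obtain J where j1: "j1 \<in> homs ?K ?I J" and j2: "j2 \<in> homs ?K ?I J"
    and uJ0: "\<forall>Q. \<forall>u\<in>homs ?K ?I Q. \<forall>v\<in>homs ?K ?I Q. Comp ?K u \<iota> = Comp ?K v \<iota> \<longrightarrow>
      (\<exists>!w. w \<in> homs ?K J Q \<and> Comp ?K w j2 = u \<and> Comp ?K w j1 = v)"
    by (rule is_pushout_homs[OF poJ \<iota> \<iota>]) blast
  \<comment> \<open>Two maps out of the empty graph always agree, so the pushout over it is a
    coproduct.\<close>
  have uJ: "\<exists>!w. w \<in> homs ?K J Q \<and> Comp ?K w j2 = u \<and> Comp ?K w j1 = v"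
    if "u \<in> homs ?K ?I Q" "v \<in> homs ?K ?I Q" for Q u v
  proof -
    have "Comp ?K u \<iota> = Comp ?K v \<iota>"
      by (rule graph_homs_eqI[OF Comp_homs[OF \<iota> that(1)] Comp_homs[OF \<iota> that(2)]]) simp
    then show ?thesis using uJ0 that by blast
  qed
  have J: "finite_graph J" using j1 by (simp add: graph_homs_iff)
  have j1C: "j1 \<in> C" by (rule cobase_change_cofibration[OF \<iota>C poJ])
  define o1 where "o1 = fn j1 ?o"
  define o2 where "o2 = fn j2 ?o"
  have loops: "{o1} \<in> edges J" "{o2} \<in> edges J"
    unfolding o1_def o2_def using fn_loop[OF j1 I(2)] fn_loop[OF j2 I(2)] by auto
  have o_verts: "o1 \<in> verts J" "o2 \<in> verts J"
    unfolding o1_def o2_def using fn_vert[OF j1 I(3)] fn_vert[OF j2 I(3)] by auto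
  have J_eq: "s = t" if s: "s \<in> homs ?K J Q" and t: "t \<in> homs ?K J Q"
    and "fn s o1 = fn t o1" "fn s o2 = fn t o2" for s t Q
  proof -
    have "Comp ?K s j1 = Comp ?K t j1"
      by (rule point_eq[OF Comp_homs[OF j1 s] Comp_homs[OF j1 t]])
        (simp add: fn_Comp[OF j1 I(3)] that o1_def[symmetric])
    moreover have "Comp ?K s j2 = Comp ?K t j2"
      by (rule point_eq[OF Comp_homs[OF j2 s] Comp_homs[OF j2 t]])
        (simp add: fn_Comp[OF j2 I(3)] that o2_def[symmetric])
    ultimately show ?thesis using uJ[OF Comp_homs[OF j2 t] Comp_homs[OF j1 t]] s t by metis
  qed

  \<comment> \<open>A cylinder \<open>Z\<close> of the point and the length \<open>L\<close> of a
    walk in it\<close>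
  obtain Z c w where c: "c \<in> homs ?K J Z" "c \<in> C" and w: "w \<in> homs ?K Z ?I" "w \<in> times_equivalences"
    using factorization_homs[OF constant_mor_homs[OF J I(1,2)]] by metis
  have Z: "finite_graph Z" using c by (simp add: graph_homs_iff)
  have cl: "{fn c o1} \<in> edges Z" "{fn c o2} \<in> edges Z" using fn_loop[OF c(1)] loops by auto
  \<comment> \<open>Both points have the same image in the one-vertex graph; the equivalence
    \<open>w\<close> lifts this to a walk in \<open>Z\<close>.\<close>
  have "fn w (fn c o2) = ?o" "fn w (fn c o1) = ?o"
    using I(4) fn_vert[OF w(1)] fn_vert[OF c(1)] o_verts by auto
  then have "(fn w (fn c o2), fn w (fn c o1)) \<in> (looped_adj ?I)\<^sup>*" by simp
  then have "(fn c o2, fn c o1) \<in> (looped_adj Z)\<^sup>*"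
    by (rule times_equivalence_connected[OF w(2,1) cl(2,1)])
  then obtain L \<beta> where \<beta>: "\<beta> 0 = fn c o2" "\<beta> L = fn c o1"
      "\<forall>i<L. (\<beta> i, \<beta> (Suc i)) \<in> looped_adj Z"
    by (rule looped_walkE) blast

  \<comment> \<open>A long contractible object \<open>M\<close> over the path\<close>
  \<comment> \<open>Large enough to exceed \<open>L\<close> and to satisfy the bound of
    \<open>cyclic_step_square\<close>.\<close>
  define n where "n = L + 5"
  let ?P = "path_graph n :: 'a graph" and ?C = "cycle_graph n :: 'a graph"
  have P: "finite_graph ?P" "{?o} \<in> edges ?P" "{numbering n} \<in> edges ?P"
    using finite_numbered_graph loop_path_graph[of 0 n] loop_path_graph[of n n] by auto
  obtain ends where ends: "ends \<in> homs ?K J ?P"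
    "Comp ?K ends j2 = constant_mor ?I ?P (numbering n)" "Comp ?K ends j1 = constant_mor ?I ?P ?o"
    using uJ[OF point[OF P(1,3)] point[OF P(1,2)]] by blast
  obtain M m u where m: "m \<in> homs ?K J M" "m \<in> C" and u: "u \<in> homs ?K M ?P" "u \<in> times_equivalences"
    and um: "ends = Comp ?K u m"
    using factorization_homs[OF ends(1)] by metis
  have M: "finite_graph M" using m by (simp add: graph_homs_iff)
  define e where "e = Comp ?K m j1"
  define a where "a = fn m o1"
  define b where "b = fn m o2"
  have ml: "{a} \<in> edges M" "{b} \<in> edges M"
    unfolding a_def b_def using fn_loop[OF m(1)] loops by auto
  have mv: "a \<in> verts M" "b \<in> verts M" using edge_verts[OF M, of a a] edge_verts[OF M, of b b] ml by auto
  have ua: "fn u a = ?o" and ub: "fn u b = numbering n"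
    using arg_cong[OF ends(3), of "\<lambda>s. fn s ?o"] arg_cong[OF ends(2), of "\<lambda>s. fn s ?o"]
    by (simp_all add: um fnp fn_Comp[OF j1 I(3)] fn_Comp[OF j2 I(3)] o1_def[symmetric]
        o2_def[symmetric] fn_Comp[OF m(1)] o_verts a_def b_def)
  have e: "e \<in> homs ?K ?I M" unfolding e_def by (rule Comp_homs[OF j1 m(1)])
  have fne: "fn e ?o = a" by (simp add: e_def fn_Comp[OF j1 I(3)] o1_def[symmetric] a_def)
  \<comment> \<open>\<open>e\<close> is the base point of \<open>M\<close>. Its image under
    \<open>u\<close> is an end of the contractible path, so \<open>e\<close> is an equivalence by
    cancelling \<open>u\<close>.\<close>
  have "Comp ?K u e = constant_mor ?I ?P ?o"
    using Comp_assoc[OF j1 m(1) u(1)] ends(3) um by (simp add: e_def)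
  then have eW: "e \<in> times_equivalences"
    using W_left_cancel[OF e u] path_graph_contractible[of n] by simp
  have eC: "e \<in> C" unfolding e_def by (rule cofibration_Comp_homs[OF j1 m(1) j1C m(2)])
  have "(a, b) \<in> (looped_adj M)\<^sup>*"
    using times_equivalence_connected[OF u(2,1) ml] path_graph_connected[of n n] by (simp add: ua ub)
  then obtain N \<alpha> where \<alpha>: "\<alpha> 0 = a" "\<alpha> N = b" "\<forall>i<N. (\<alpha> i, \<alpha> (Suc i)) \<in> looped_adj M"
    by (rule looped_walkE) blast
  have \<alpha>v: "\<alpha> i \<in> verts M" if "i \<le> N" for i
  proof (cases "i = N")
    case False
    then have "{\<alpha> i, \<alpha> i} \<in> edges M" using \<alpha>(3)[rule_format, of i] that by (simp add: looped_adj_def)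
    then show ?thesis using edge_verts[OF M] by blast
  qed (simp add: \<alpha> mv)
  have \<beta>v: "\<beta> i \<in> verts Z" if "i \<le> L" for i
  proof (cases "i = L")
    case True
    then show ?thesis using edge_verts[OF Z, of "fn c o1" "fn c o1"] cl by (simp add: \<beta>)
  next
    case False
    then have "{\<beta> i, \<beta> i} \<in> edges Z" using \<beta>(3)[rule_format, of i] that by (simp add: looped_adj_def)
    then show ?thesis using edge_verts[OF Z] by blast
  qed
  define p where "p = constant_mor M ?I ?o"
  have p: "p \<in> homs ?K M ?I" unfolding p_def by (rule constant_mor_homs[OF M I(1,2)])
  have fnp0: "fn p x = ?o" if "x \<in> verts M" for x using that by (simp add: p_def fn_constant_mor)
  have pe: "Comp ?K p e = Ident ?K ?I"
    by (rule point_eq[OF Comp_homs[OF e p] Ident_homs[OF \<open>?I \<in> Obj ?K\<close>]])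
      (simp add: fn_Comp[OF e I(3)] fne fnp0 mv fn_Ident I(3))

  \<comment> \<open>The glued object \<open>T\<close> and its map to the cycle\<close>
  have "\<exists>f z. is_pushout ?K c m f z"
    using c m by (intro graph_pushout_exists) (auto simp: homs_def)
  then obtain f z where poT: "is_pushout ?K c m f z" by blast
  obtain T where f: "f \<in> homs ?K M T" and z: "z \<in> homs ?K Z T" and zc: "Comp ?K z c = Comp ?K f m"
    and uT: "\<forall>Q. \<forall>u\<in>homs ?K Z Q. \<forall>v\<in>homs ?K M Q. Comp ?K u c = Comp ?K v m \<longrightarrow>
      (\<exists>!w. w \<in> homs ?K T Q \<and> Comp ?K w z = u \<and> Comp ?K w f = v)"
    by (rule is_pushout_homs[OF poT c(1) m(1)]) blast
  have T: "finite_graph T" using f by (simp add: graph_homs_iff)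
  have fC: "f \<in> C" by (rule cobase_change_cofibration[OF c(2) poT])
  have glue: "fn z (fn c s) = fn f (fn m s)" if "s \<in> verts J" for s
    using arg_cong[OF zc, of "\<lambda>h. fn h s"] that by (simp add: fn_Comp[OF c(1)] fn_Comp[OF m(1)])

  have Cy: "finite_graph ?C" "{?o} \<in> edges ?C"
    using finite_numbered_graph loop_cycle_graph[of n] by (auto simp: n_def)
  define \<kappa> where "\<kappa> = \<lparr>src = ?P, tgt = ?C, fn = restrict (\<lambda>s. numbering (number s mod n)) (verts ?P)\<rparr>"
  have \<kappa>: "\<kappa> \<in> homs ?K ?P ?C"
    unfolding \<kappa>_def by (rule graph_hom_restrict[OF P(1) Cy(1) wrap_path_graph]) (simp add: n_def)
  have fn\<kappa>: "fn \<kappa> s = numbering (number s mod n)" if "s \<in> verts ?P" for s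
    using that by (simp add: \<kappa>_def)
  have \<kappa>u: "Comp ?K \<kappa> u \<in> homs ?K M ?C" by (rule Comp_homs[OF u(1) \<kappa>])
  have fn\<kappa>u: "fn (Comp ?K \<kappa> u) s = numbering (number (fn u s) mod n)" if "s \<in> verts M" for s
    using that by (simp add: fn_Comp[OF u(1)] fn\<kappa> fn_vert[OF u(1)])
  have zero: "constant_mor Z ?C ?o \<in> homs ?K Z ?C" by (rule constant_mor_homs[OF Z Cy])
  \<comment> \<open>The two maps agree on \<open>J\<close> because wrapping sends both ends of the
    path to \<open>0\<close>.\<close>
  have "Comp ?K (constant_mor Z ?C ?o) c = Comp ?K (Comp ?K \<kappa> u) m"
    by (rule J_eq[OF Comp_homs[OF c(1) zero] Comp_homs[OF m(1) \<kappa>u]])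
      (simp_all add: fn_Comp[OF c(1)] fn_Comp[OF m(1)] o_verts fn_constant_mor fn_vert[OF c(1)]
        a_def[symmetric] b_def[symmetric] mv fn\<kappa>u ua ub)
  then obtain \<phi> where \<phi>: "\<phi> \<in> homs ?K T ?C" "Comp ?K \<phi> z = constant_mor Z ?C ?o"
      "Comp ?K \<phi> f = Comp ?K \<kappa> u"
    using uT[rule_format, OF zero \<kappa>u] by blast
  define l where "l = (int \<circ> number) \<circ> fn \<phi>"
  have l: "cyclic_labelling (int n) T l"
    unfolding l_def using homs_graph_map[OF \<phi>(1)] by (intro cyclic_labelling_comp[OF cyclic_labelling_number]) auto
  have lz: "l (fn z s) = 0" if "s \<in> verts Z" for s
    using arg_cong[OF \<phi>(2), of "\<lambda>h. fn h s"] that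
    by (simp add: l_def fn_Comp[OF z] fn_constant_mor)
  have lf: "l (fn f s) = int (number (fn u s) mod n)" if "s \<in> verts M" for s
    using arg_cong[OF \<phi>(3), of "\<lambda>h. fn h s"] that
    by (simp add: l_def fn_Comp[OF f] fn\<kappa>u)

  \<comment> \<open>A closed walk in \<open>T\<close> going once around the cycle\<close>
  \<comment> \<open>Out through \<open>M\<close> from \<open>a\<close> to \<open>b\<close>, then
    back through \<open>Z\<close> along \<beta>, which runs from the second point to the
    first.\<close>
  define \<gamma> where "\<gamma> i = (if i < N then fn f (\<alpha> i) else fn z (\<beta> (i - N)))" for i
  have join: "fn f (\<alpha> N) = fn z (\<beta> 0)" "fn z (\<beta> L) = fn f (\<alpha> 0)"
    using glue[OF o_verts(1)] glue[OF o_verts(2)] by (simp_all add: \<alpha> \<beta> a_def b_def)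
  have \<gamma>: "closed_looped_walk T (N + L) \<gamma>"
    unfolding closed_looped_walk_def
  proof (intro conjI allI impI)
    show "\<gamma> (N + L) = \<gamma> 0" using join by (cases "N = 0") (auto simp: \<gamma>_def)
    fix i assume i: "i < N + L"
    show "(\<gamma> i, \<gamma> (Suc i)) \<in> looped_adj T"
    proof (cases "i < N")
      case True
      then have "(fn f (\<alpha> i), fn f (\<alpha> (Suc i))) \<in> looped_adj T"
        using looped_adj_map[of M T "fn f"] homs_graph_map[OF f] \<alpha>(3) by blast
      then show ?thesis using True join by (cases "Suc i = N") (auto simp: \<gamma>_def)
    next
      case False
      then have "(fn z (\<beta> (i - N)), fn z (\<beta> (Suc (i - N)))) \<in> looped_adj T"
        using looped_adj_map[of Z T "fn z"] homs_graph_map[OF z] \<beta>(3)[rule_format, of "i - N"] i by auto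
      then show ?thesis using False by (simp add: \<gamma>_def Suc_diff_le)
    qed
  qed
  have split: "winding (int n) (h \<circ> \<gamma>) (N + L) =
      winding (int n) (\<lambda>i. h (fn f (\<alpha> i))) N + winding (int n) (\<lambda>i. h (fn z (\<beta> i))) L" for h
    using winding_concat[of "\<lambda>i. h (fn f (\<alpha> i))" N "\<lambda>i. h (fn z (\<beta> i))" "int n" L] join
    by (simp add: \<gamma>_def comp_def if_distrib[of h])
  have "winding (int n) (l \<circ> \<gamma>) (N + L) = int n"
  proof -
    have "winding (int n) (\<lambda>i. l (fn z (\<beta> i))) L = 0"
      unfolding winding_def by (rule sum.neutral) (simp add: lz \<beta>v cyclic_step_same n_def)
    moreover have "winding (int n) (\<lambda>i. l (fn f (\<alpha> i))) N =
        winding (int n) (\<lambda>i. int (number (fn u (\<alpha> i)) mod n)) N"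
      unfolding winding_def by (rule sum.cong) (simp_all add: lf \<alpha>v)
    moreover have "\<dots> = int n"
    proof (rule winding_wrapped_walk)
      show "{fn u (\<alpha> i), fn u (\<alpha> (Suc i))} \<in> edges ?P" if "i < N" for i
        by (rule fn_edge[OF u(1)]) (use \<alpha>(3) that in \<open>simp add: looped_adj_def\<close>)
    qed (simp_all add: n_def[symmetric] \<alpha> ua ub, simp add: n_def)
    ultimately show ?thesis by (simp add: split)
  qed

  \<comment> \<open>Collapsing \<open>M\<close> in the second copy of \<open>T\<close>\<close>
  obtain V V' k1 k2 q v where k1: "k1 \<in> homs ?K T V" and k2: "k2 \<in> homs ?K T V"
    and q: "q \<in> homs ?K V T" "q \<in> times_equivalences"
    and qk1: "Comp ?K q k1 = Ident ?K T" and qk2: "Comp ?K q k2 = Ident ?K T"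
    and v: "v \<in> homs ?K V V'" and vk1: "Comp ?K v k1 \<in> times_equivalences"
    and vk2: "Comp ?K (Comp ?K v k2) f = Comp ?K (Comp ?K v k1) (Comp ?K f (Comp ?K e p))"
    by (rule collapse_second_copy[OF graph_pushout_exists e IntI[OF eW eC] p pe f fC])
  have V: "finite_graph V" "finite_graph V'" using v by (auto simp: graph_homs_iff)
  obtain \<rho> where \<rho>: "graph_map V' T \<rho>" "times_homotopic T T (\<rho> \<circ> fn (Comp ?K v k1)) id"
    using times_equivalenceE[OF vk1 Comp_homs[OF k1 v]] by metis
  obtain q' where q': "graph_map T V q'" "times_homotopic V V (q' \<circ> fn q) id"
    using times_equivalenceE[OF q(2,1)] by metis
  have \<gamma>v: "\<gamma> i \<in> verts T" if "i \<le> N + L" for i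
    using that \<alpha>v \<beta>v fn_vert[OF f] fn_vert[OF z] by (auto simp: \<gamma>_def)
  \<comment> \<open>The labelling of \<open>T\<close> is pulled back to \<open>V\<close> through
    \<open>V'\<close>: up to homotopy it restricts to \<open>l\<close> on the first copy, while the
    collapse is visible on the second.\<close>
  define l' where "l' = l \<circ> \<rho> \<circ> fn v"
  have l': "cyclic_labelling (int n) V l'"
    unfolding l'_def using cyclic_labelling_comp[OF cyclic_labelling_comp[OF l \<rho>(1) V(2)]] homs_graph_map[OF v]
    by blast
  have n5: "int n \<ge> 5" by (simp add: n_def)
  have wcong: "winding (int n) s (N + L) = winding (int n) t (N + L)"
    if "\<And>i. i \<le> N + L \<Longrightarrow> s i = t i" for s t
    unfolding winding_def by (rule sum.cong) (use that in auto)
  have first: "winding (int n) (l' \<circ> (fn k1 \<circ> \<gamma>)) (N + L) = winding (int n) (l \<circ> \<gamma>) (N + L)"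
  proof -
    have "winding (int n) (l' \<circ> (fn k1 \<circ> \<gamma>)) (N + L) =
        winding (int n) (l \<circ> (\<rho> \<circ> fn (Comp ?K v k1)) \<circ> \<gamma>) (N + L)"
      by (rule wcong) (simp add: l'_def fn_Comp[OF k1] \<gamma>v)
    then show ?thesis using winding_homotopy_invariant[OF \<rho>(2) T n5 l \<gamma>] by simp
  qed
  \<comment> \<open>Both copies of \<open>T\<close> in \<open>V\<close> are sections of the equivalence \<open>q\<close>, hence homotopic.\<close>
  have copies: "winding (int n) (l' \<circ> (fn k \<circ> \<gamma>)) (N + L) = winding (int n) (l' \<circ> q' \<circ> \<gamma>) (N + L)"
    if k: "k \<in> homs ?K T V" "Comp ?K q k = Ident ?K T" for k
  proof -
    have "closed_looped_walk V (N + L) (fn k \<circ> \<gamma>)"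
      using closed_looped_walk_map[OF \<gamma>] homs_graph_map[OF k(1)] by blast
    from winding_homotopy_invariant[OF q'(2) V(1) n5 l' this]
    have "winding (int n) (l' \<circ> (fn k \<circ> \<gamma>)) (N + L) =
        winding (int n) (l' \<circ> (q' \<circ> fn q) \<circ> (fn k \<circ> \<gamma>)) (N + L)" by simp
    also have "\<dots> = winding (int n) (l' \<circ> q' \<circ> \<gamma>) (N + L)"
    proof (rule wcong)
      fix i assume "i \<le> N + L"
      then have "fn q (fn k (\<gamma> i)) = \<gamma> i"
        using arg_cong[OF k(2), of "\<lambda>h. fn h (\<gamma> i)"] \<gamma>v by (simp add: fn_Comp[OF k(1)] fn_Ident)
      then show "(l' \<circ> (q' \<circ> fn q) \<circ> (fn k \<circ> \<gamma>)) i = (l' \<circ> q' \<circ> \<gamma>) i" by simp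
    qed
    finally show ?thesis .
  qed
  have "\<bar>winding (int n) (l' \<circ> (fn k2 \<circ> \<gamma>)) (N + L)\<bar> \<le> int L"
  proof -
    \<comment> \<open>All of the second \<open>M\<close> goes to one vertex of \<open>V'\<close>, so
      only the \<open>L\<close> steps through \<open>Z\<close> contribute, each at most 1 in
      absolute value.\<close>
    have "fn v (fn k2 (fn f s)) = fn v (fn k1 (fn f a))" if "s \<in> verts M" for s
      using arg_cong[OF vk2, of "\<lambda>h. fn h s"] that
      by (simp add: fn_Comp[OF f] fn_Comp[OF k1] fn_Comp[OF k2] fn_Comp[OF p] fn_vert[OF f] mv
          fn_Comp[OF Comp_homs[OF p e]] fn_Comp[OF Comp_homs[OF Comp_homs[OF p e] f]] fnp0 fne)
    then have "winding (int n) (\<lambda>i. l' (fn k2 (fn f (\<alpha> i)))) N = 0"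
      unfolding winding_def l'_def
      by (intro sum.neutral) (simp add: \<alpha>v cyclic_step_same n_def)
    moreover have "\<bar>winding (int n) (\<lambda>i. l' (fn k2 (fn z (\<beta> i)))) L\<bar> \<le> int L"
    proof (rule winding_bound)
      fix i assume "i < L"
      then have "{fn k2 (fn z (\<beta> i)), fn k2 (fn z (\<beta> (Suc i)))} \<in> edges V"
        using \<beta>(3) fn_edge[OF k2] fn_edge[OF z] by (auto simp: looped_adj_def)
      then show "\<bar>cyclic_step (int n) (l' (fn k2 (fn z (\<beta> i)))) (l' (fn k2 (fn z (\<beta> (Suc i)))))\<bar> \<le> 1"
        using l' by (simp add: cyclic_labelling_def)
    qed
    ultimately show ?thesis using split[of "l' \<circ> fn k2"] by (simp add: comp_assoc)
  qed
  then show False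
    using first copies[OF k1 qk1] copies[OF k2 qk2] \<open>winding (int n) (l \<circ> \<gamma>) (N + L) = int n\<close>
    by (simp add: n_def)
qed

theorem corollary3p3:
  fixes C :: "'a::infinite graph_mor set"
  assumes "cofibration_category graph_category times_equivalences C"
  shows "C \<subseteq> induced_inclusions"
  using no_cofibration_category assms by blast

end
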